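(* Let $n\ge2$. Given any phase function $\phi$ on $S_n$ and any $k\in\{0,\dots,n-1\}$, the function $$c=(c_0,\dots,c_{n-1})\longmapsto G_k(\mathrm{circ}(c_0,\dots,c_{n-1}))$$ is a homogeneous polynomial of degree $n$ in the variables $c_j$, whereas $$c\longmapsto\lambda_k(\mathrm{circ}(c))=\sum_{j=0}^{n-1}c_j\,\omega^{kj}$$ is homogeneous of degree $1$. Therefore the identity $G_k(C)=\lambda_k(C)$ for all circulant matrices $C\in M_n(\mathbb{C})$ is impossible.
   Context: Let $\omega=e^{2\pi i/n}$, let $S_n$ be the symmetric group on $\{1,\dots,n\}$ with composition $(\sigma\circ\tau)(i)=\sigma(\tau(i))$, let $\varepsilon(\sigma)$ be the sign of $\sigma$, and let $\rho=(1\,2\,\cdots\,n)$ be the cycle $\rho(i)=i+1$ for $i<n$, $\rho(n)=1$. A phase function is a map $\phi:S_n\to\mathbb{Z}/n\mathbb{Z}$ such that for every $\sigma^*\in S_n$ with $\sigma^*(1)=1$ and every $r\in\mathbb{Z}/n\mathbb{Z}$ one has $\phi(\sigma^*\circ\rho^r)=r$. For $A=(a_{ij})\in M_n(\mathbb{C})$ put $m_\sigma(A)=\varepsilon(\sigma)\prod_{i=1}^n a_{i,\sigma(i)}$, $\Lambda_r(A)=\sum_{\sigma:\phi(\sigma)=r}m_\sigma(A)$ for $r=0,\dots,n-1$, and $G_k(A)=\sum_{r=0}^{n-1}\Lambda_r(A)\omega^{kr}$. $\mathrm{circ}(c_0,\dots,c_{n-1})$ is the $n\times n$ circulant matrix with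 first row $(c_0,\dots,c_{n-1})$, i.e. with $(i,j)$ entry $c_{(j-i)\bmod n}$; its eigenvalues are $\lambda_k(\mathrm{circ}(c))=\sum_{j}c_j\omega^{kj}$, $k=0,\dots,n-1$. *)

theory Defs
  imports
    "HOL-Library.Poly_Mapping"
    "HOL-Combinatorics.Permutations"
    "Jordan_Normal_Form.Char_Poly"
begin

definition omega :: "nat \<Rightarrow> complex" where
  "omega n = exp (2 * complex_of_real pi * \<i> / of_nat n)"

text \<open>
  The symmetric group on the letters 1 to n is the set of all functions
  \<open>\<sigma> :: nat \<Rightarrow> nat\<close> with \<open>\<sigma> permutes {1..n}\<close>; these are the identity
  outside \<open>{1..n}\<close>, and so is the cycle \<open>rho n\<close>.
\<close>

definition rho :: "nat \<Rightarrow> nat \<Rightarrow> nat" where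
  "rho n i = (if 1 \<le> i \<and> i < n then i + 1 else if i = n then 1 else i)"

text \<open>
  The residue classes modulo n are represented by the numbers 0 to n - 1.
\<close>

definition phase_function :: "nat \<Rightarrow> ((nat \<Rightarrow> nat) \<Rightarrow> nat) \<Rightarrow> bool" where
  "phase_function n \<phi> \<longleftrightarrow>
     (\<forall>\<sigma>. \<sigma> permutes {1..n} \<longrightarrow> \<phi> \<sigma> < n) \<and>
     (\<forall>\<sigma> r. \<sigma> permutes {1..n} \<and> \<sigma> 1 = 1 \<and> r < n \<longrightarrow> \<phi> (\<sigma> \<circ> (rho n ^^ r)) = r)"

text \<open>
  The rows and columns of a matrix of type \<open>complex mat\<close> are numbered from 0,
  so the entry with indices i and j in \<open>{1..n}\<close> is \<open>A $$ (i - 1, j - 1)\<close>.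
\<close>

definition signed_term :: "nat \<Rightarrow> (nat \<Rightarrow> nat) \<Rightarrow> complex mat \<Rightarrow> complex" where
  "signed_term n \<sigma> A = of_int (sign \<sigma>) * (\<Prod>i\<in>{1..n}. A $$ (i - 1, \<sigma> i - 1))"

definition Lambda :: "nat \<Rightarrow> ((nat \<Rightarrow> nat) \<Rightarrow> nat) \<Rightarrow> nat \<Rightarrow> complex mat \<Rightarrow> complex" where
  "Lambda n \<phi> r A = (\<Sum>\<sigma> | \<sigma> permutes {1..n} \<and> \<phi> \<sigma> = r. signed_term n \<sigma> A)"

definition G :: "nat \<Rightarrow> ((nat \<Rightarrow> nat) \<Rightarrow> nat) \<Rightarrow> nat \<Rightarrow> complex mat \<Rightarrow> complex" where
  "G n \<phi> k A = (\<Sum>r<n. Lambda n \<phi> r A * omega n ^ (k * r))"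

text \<open>
  The entry is the coefficient of c at (j - i) modulo n; the summand n keeps the
  subtraction on the natural numbers from truncating.
\<close>

definition circ :: "nat \<Rightarrow> complex vec \<Rightarrow> complex mat" where
  "circ n c = mat n n (\<lambda>(i, j). c $ ((j + n - i) mod n))"

definition circulant :: "nat \<Rightarrow> complex mat \<Rightarrow> bool" where
  "circulant n C \<longleftrightarrow> (\<exists>c \<in> carrier_vec n. C = circ n c)"

text \<open>
  The k-th eigenvalue of a circulant matrix, as a function of the matrix: the
  coefficients are read off the first row.
\<close>

definition circ_eigenvalue :: "nat \<Rightarrow> nat \<Rightarrow> complex mat \<Rightarrow> complex" where
  "circ_eigenvalue n k C = (\<Sum>j<n. C $$ (0, j) * omega n ^ (k * j))"

text \<open>
  Formal polynomials over the complex numbers in variables indexed by natural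
  numbers: a monomial is a finitely supported map from variables to exponents, and
  a polynomial is a finitely supported map from monomials to coefficients.
\<close>

type_synonym cpoly = "(nat \<Rightarrow>\<^sub>0 nat) \<Rightarrow>\<^sub>0 complex"

definition monom_degree :: "(nat \<Rightarrow>\<^sub>0 nat) \<Rightarrow> nat" where
  "monom_degree m = (\<Sum>j \<in> Poly_Mapping.keys m. Poly_Mapping.lookup m j)"

definition eval_cpoly :: "cpoly \<Rightarrow> complex vec \<Rightarrow> complex" where
  "eval_cpoly p c = (\<Sum>m \<in> Poly_Mapping.keys p. Poly_Mapping.lookup p m * (\<Prod>j \<in> Poly_Mapping.keys m. (c $ j) ^ Poly_Mapping.lookup m j))"

text \<open>
  The zero polynomial is excluded, so a function has at most one degree in this
  sense.
\<close>

definition homogeneous_polynomial_function ::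
    "nat \<Rightarrow> nat \<Rightarrow> (complex vec \<Rightarrow> complex) \<Rightarrow> bool" where
  "homogeneous_polynomial_function n d F \<longleftrightarrow>
     (\<exists>p :: cpoly. p \<noteq> 0 \<and>
        (\<forall>m \<in> Poly_Mapping.keys p. Poly_Mapping.keys m \<subseteq> {..<n} \<and> monom_degree m = d) \<and>
        (\<forall>c \<in> carrier_vec n. F c = eval_cpoly p c))"

lemma omega_power_n: "0 < n \<Longrightarrow> omega n ^ n = 1"
  unfolding omega_def exp_of_nat_mult [symmetric] by simp

lemma omega_power_mod:
  assumes "0 < n"
  shows "omega n ^ (k * (m mod n)) = omega n ^ (k * m)"
proof -
  have "omega n ^ (k * m) = omega n ^ (k * (m mod n) + n * (k * (m div n)))"
    by (metis add.commute distrib_left mult.left_commute mult_div_mod_eq)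
  also have "\<dots> = omega n ^ (k * (m mod n)) * (omega n ^ n) ^ (k * (m div n))"
    by (simp only: power_add power_mult)
  finally show ?thesis
    by (simp add: omega_power_n [OF assms])
qed

lemma circ_eigenvalue_circ:
  "circ_eigenvalue n k (circ n c) = (\<Sum>j<n. c $ j * omega n ^ (k * j))"
  unfolding circ_eigenvalue_def by (intro sum.cong) (auto simp: circ_def)

lemma eigenvector_circ:
  assumes n: "0 < n"
  shows "eigenvector (circ n c) (vec n (\<lambda>j. omega n ^ (k * j))) (circ_eigenvalue n k (circ n c))"
proof -
  let ?w = "omega n" and ?v = "vec n (\<lambda>j. omega n ^ (k * j))"
  have row: "(\<Sum>j<n. c $ ((j + n - i) mod n) * ?w ^ (k * j))
      = (\<Sum>j<n. c $ j * ?w ^ (k * j)) * ?w ^ (k * i)" if i: "i < n" for i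
  proof -
    have "(\<Sum>j<n. c $ ((j + n - i) mod n) * ?w ^ (k * j))
        = (\<Sum>m<n. c $ m * (?w ^ (k * m) * ?w ^ (k * i)))"
    proof (rule sum.reindex_bij_witness [of _ "\<lambda>m. (m + i) mod n" "\<lambda>j. (j + n - i) mod n"])
      fix j assume j: "j \<in> {..<n}"
      show "((j + n - i) mod n + i) mod n = j"
        using i j by (simp add: mod_add_left_eq)
      have "?w ^ (k * ((j + n - i) mod n)) * ?w ^ (k * i) = ?w ^ (k * (j + n - i + i))"
        by (simp only: omega_power_mod [OF n] power_add [symmetric] distrib_left)
      also have "\<dots> = ?w ^ (k * ((j + n) mod n))"
        using i omega_power_mod [OF n, of k "j + n"] by simp
      also have "(j + n) mod n = j"
        using j by simp
      finally show "c $ ((j + n - i) mod n) * (?w ^ (k * ((j + n - i) mod n)) * ?w ^ (k * i))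
          = c $ ((j + n - i) mod n) * ?w ^ (k * j)"
        by simp
    next
      fix m assume m: "m \<in> {..<n}"
      show "((m + i) mod n + n - i) mod n = m"
      proof (cases "m + i < n")
        case True
        then show ?thesis using m by simp
      next
        case False
        then have "(m + i) mod n = m + i - n"
          using m i by (simp add: mod_if)
        then show ?thesis using m i False by simp
      qed
    qed (use n in auto)
    then show ?thesis
      by (simp add: sum_distrib_right mult.assoc)
  qed
  have "circ n c *\<^sub>v ?v = circ_eigenvalue n k (circ n c) \<cdot>\<^sub>v ?v"
  proof (rule eq_vecI)
    fix i assume "i < dim_vec (circ_eigenvalue n k (circ n c) \<cdot>\<^sub>v ?v)"
    then have i: "i < n" by simp
    then have "(circ n c *\<^sub>v ?v) $ i = (\<Sum>j<n. c $ ((j + n - i) mod n) * ?w ^ (k * j))"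
      by (simp add: circ_def scalar_prod_def atLeast0LessThan)
    then show "(circ n c *\<^sub>v ?v) $ i = (circ_eigenvalue n k (circ n c) \<cdot>\<^sub>v ?v) $ i"
      using i row [OF i] by (simp add: circ_eigenvalue_circ)
  qed (simp add: circ_def)
  moreover have "?v \<noteq> 0\<^sub>v n"
  proof
    assume "?v = 0\<^sub>v n"
    then have "?v $ 0 = 0\<^sub>v n $ 0" by simp
    then show False using n by simp
  qed
  ultimately show ?thesis
    unfolding eigenvector_def by (simp add: circ_def)
qed

end

theory Submission
  imports Defs
begin

text \<open>
  Every entry of a circulant matrix is one of the variables \<open>c\<^sub>0, \<dots>, c\<^sub>n\<^sub>-\<^sub>1\<close>, so each signed
  term of the Leibniz expansion is a scalar times a product of \<open>n\<close> variables, and \<open>G\<^sub>k\<close> is a linear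
  combination of such products. Hence it is given by a homogeneous polynomial of degree \<open>n\<close>; what
  could still go wrong is that the terms cancel and leave the zero polynomial.

  Both this and the final claim are settled on the line of scalar matrices
  \<open>t I = circ(t, 0, \<dots>, 0)\<close>. There only the identity permutation contributes, and its phase is 0
  because it is the product of the identity, which fixes 1, with the zeroth power of the cycle.
  So \<open>G\<^sub>k(t I) = t\<^sup>n\<close>, whereas \<open>\<lambda>\<^sub>k(t I) = t\<close>. At \<open>t = 1\<close> both are nonzero, which excludes the zero
  polynomial; at \<open>t = 2\<close> they differ, as \<open>n \<ge> 2\<close>.
\<close>

section \<open>Functions given by forms\<close>

text \<open>
  Unlike \<^const>\<open>homogeneous_polynomial_function\<close>, this notion admits the zero polynomial in every
  degree. That makes it closed under linear combinations, so the nonvanishing can be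
  established separately by evaluation at one point.
\<close>

definition form_function :: "nat \<Rightarrow> nat \<Rightarrow> (complex vec \<Rightarrow> complex) \<Rightarrow> bool" where
  "form_function n d F \<longleftrightarrow>
     (\<exists>p :: cpoly.
        (\<forall>m \<in> Poly_Mapping.keys p. Poly_Mapping.keys m \<subseteq> {..<n} \<and> monom_degree m = d) \<and>
        (\<forall>c \<in> carrier_vec n. F c = eval_cpoly p c))"

lemma homogeneous_polynomial_function_if_nonzero_value:
  assumes "form_function n d F" and "c \<in> carrier_vec n" and "F c \<noteq> 0"
  shows "homogeneous_polynomial_function n d F"
proof -
  obtain p where p: "\<forall>m \<in> Poly_Mapping.keys p. Poly_Mapping.keys m \<subseteq> {..<n} \<and> monom_degree m = d"
      "\<forall>c \<in> carrier_vec n. F c = eval_cpoly p c"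
    using assms(1) unfolding form_function_def by blast
  have "p \<noteq> 0"
    using assms p(2) by (auto simp: eval_cpoly_def)
  with p show ?thesis
    unfolding homogeneous_polynomial_function_def by blast
qed

text \<open>
  The sum defining the value of a polynomial runs over its own monomials. Enlarging the index set
  lets two polynomials be evaluated over a common one, which is what additivity needs.
\<close>

lemma eval_cpoly_superset:
  assumes "finite S" and "Poly_Mapping.keys p \<subseteq> S"
  shows "eval_cpoly p c = (\<Sum>m\<in>S. Poly_Mapping.lookup p m *
    (\<Prod>j \<in> Poly_Mapping.keys m. (c $ j) ^ Poly_Mapping.lookup m j))"
  unfolding eval_cpoly_def using assms
  by (intro sum.mono_neutral_left) (auto simp: in_keys_iff)

lemma eval_cpoly_add: "eval_cpoly (p + q) c = eval_cpoly p c + eval_cpoly q c"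
proof -
  let ?S = "Poly_Mapping.keys p \<union> Poly_Mapping.keys q"
  have "Poly_Mapping.keys (p + q) \<subseteq> ?S"
    by (rule Poly_Mapping.keys_add)
  then show ?thesis
    by (simp add: eval_cpoly_superset [of ?S] lookup_add distrib_right sum.distrib)
qed

lemma form_function_zero: "form_function n d (\<lambda>c. 0)"
  unfolding form_function_def by (intro exI [of _ 0]) (simp add: eval_cpoly_def)

lemma form_function_add:
  assumes "form_function n d F" and "form_function n d H"
  shows "form_function n d (\<lambda>c. F c + H c)"
proof -
  obtain p where p: "\<forall>m \<in> Poly_Mapping.keys p. Poly_Mapping.keys m \<subseteq> {..<n} \<and> monom_degree m = d"
      "\<forall>c \<in> carrier_vec n. F c = eval_cpoly p c"
    using assms(1) unfolding form_function_def by blast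
  obtain q where q: "\<forall>m \<in> Poly_Mapping.keys q. Poly_Mapping.keys m \<subseteq> {..<n} \<and> monom_degree m = d"
      "\<forall>c \<in> carrier_vec n. H c = eval_cpoly q c"
    using assms(2) unfolding form_function_def by blast
  have "\<forall>m \<in> Poly_Mapping.keys (p + q). Poly_Mapping.keys m \<subseteq> {..<n} \<and> monom_degree m = d"
    using p(1) q(1) Poly_Mapping.keys_add [of p q] by blast
  then show ?thesis
    unfolding form_function_def using p(2) q(2)
    by (intro exI [of _ "p + q"]) (simp add: eval_cpoly_add)
qed

lemma form_function_sum:
  assumes "\<And>x. x \<in> S \<Longrightarrow> form_function n d (F x)"
  shows "form_function n d (\<lambda>c. \<Sum>x\<in>S. F x c)"
  using assms
  by (induction S rule: infinite_finite_induct)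
    (auto intro: form_function_zero form_function_add)

text \<open>
  The exponent of the \<open>j\<close>-th variable in the collected monomial is the number of indices that
  \<open>f\<close> sends to \<open>j\<close>. Sums and products over all \<open>j < n\<close> instead of the support turn the induction
  step into the addition of 1 to a single exponent.
\<close>

lemma product_of_variables_monomial:
  assumes "finite I" and "f ` I \<subseteq> {..<n}"
  shows "\<exists>m :: nat \<Rightarrow>\<^sub>0 nat. Poly_Mapping.keys m \<subseteq> {..<n} \<and> monom_degree m = card I \<and>
    (\<forall>c :: complex vec. (\<Prod>i\<in>I. c $ f i) =
      (\<Prod>j \<in> Poly_Mapping.keys m. (c $ j) ^ Poly_Mapping.lookup m j))"
proof -
  have "\<exists>m :: nat \<Rightarrow>\<^sub>0 nat. Poly_Mapping.keys m \<subseteq> {..<n} \<and>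
      (\<Sum>j<n. Poly_Mapping.lookup m j) = card I \<and>
      (\<forall>c :: complex vec. (\<Prod>i\<in>I. c $ f i) = (\<Prod>j<n. (c $ j) ^ Poly_Mapping.lookup m j))"
    using assms
  proof (induction I rule: finite_induct)
    case empty
    show ?case by (intro exI [of _ 0]) simp
  next
    case (insert a I)
    then obtain m :: "nat \<Rightarrow>\<^sub>0 nat" where m: "Poly_Mapping.keys m \<subseteq> {..<n}"
        "(\<Sum>j<n. Poly_Mapping.lookup m j) = card I"
        "\<And>c :: complex vec. (\<Prod>i\<in>I. c $ f i) = (\<Prod>j<n. (c $ j) ^ Poly_Mapping.lookup m j)"
      by auto
    let ?e = "Poly_Mapping.single (f a) (1 :: nat)"
    have fa: "f a < n" using insert.prems by simp
    have "Poly_Mapping.keys (m + ?e) \<subseteq> {..<n}"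
      using Poly_Mapping.keys_add [of m ?e] m(1) fa by auto
    moreover have "(\<Sum>j<n. Poly_Mapping.lookup (m + ?e) j) = card (insert a I)"
      using insert.hyps fa m(2) by (simp add: lookup_add lookup_single when_def sum.distrib)
    moreover have "(\<Prod>i\<in>insert a I. c $ f i) =
        (\<Prod>j<n. (c $ j) ^ Poly_Mapping.lookup (m + ?e) j)" for c :: "complex vec"
    proof -
      have "(\<Prod>j<n. (c $ j) ^ Poly_Mapping.lookup ?e j) = (\<Prod>j<n. if f a = j then c $ j else 1)"
        by (intro prod.cong) (auto simp: lookup_single)
      also have "\<dots> = c $ f a" using fa by simp
      finally show ?thesis
        using insert.hyps m(3) [of c] by (simp add: lookup_add power_add prod.distrib)
    qed
    ultimately show ?case by blast
  qed
  then obtain m :: "nat \<Rightarrow>\<^sub>0 nat" where m: "Poly_Mapping.keys m \<subseteq> {..<n}"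
      "(\<Sum>j<n. Poly_Mapping.lookup m j) = card I"
      "\<And>c :: complex vec. (\<Prod>i\<in>I. c $ f i) = (\<Prod>j<n. (c $ j) ^ Poly_Mapping.lookup m j)"
    by blast
  have "monom_degree m = card I"
    unfolding monom_degree_def m(2) [symmetric] using m(1)
    by (intro sum.mono_neutral_left) (auto simp: in_keys_iff)
  moreover have "(\<Prod>j \<in> Poly_Mapping.keys m. (c $ j) ^ Poly_Mapping.lookup m j) =
      (\<Prod>j<n. (c $ j) ^ Poly_Mapping.lookup m j)" for c :: "complex vec"
    using m(1) by (intro prod.mono_neutral_left) (auto simp: in_keys_iff)
  ultimately show ?thesis
    using m by auto
qed

lemma form_function_product_of_variables:
  assumes "finite I" and "f ` I \<subseteq> {..<n}" and "card I = d"
  shows "form_function n d (\<lambda>c. a * (\<Prod>i\<in>I. c $ f i))"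
proof -
  obtain m :: "nat \<Rightarrow>\<^sub>0 nat" where m: "Poly_Mapping.keys m \<subseteq> {..<n}" "monom_degree m = card I"
      "\<And>c :: complex vec. (\<Prod>i\<in>I. c $ f i) =
        (\<Prod>j \<in> Poly_Mapping.keys m. (c $ j) ^ Poly_Mapping.lookup m j)"
    using product_of_variables_monomial [OF assms(1,2)] by blast
  show ?thesis
    unfolding form_function_def
  proof (intro exI [of _ "Poly_Mapping.single m a"] conjI ballI)
    fix m' assume "m' \<in> Poly_Mapping.keys (Poly_Mapping.single m a)"
    then have "m' = m" by (simp split: if_splits)
    then show "Poly_Mapping.keys m' \<subseteq> {..<n}" and "monom_degree m' = d"
      using m(1,2) assms(3) by auto
  next
    fix c :: "complex vec"
    \<comment> \<open>For \<open>a = 0\<close> the singleton polynomial has no monomials, hence the larger index set.\<close>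
    show "a * (\<Prod>i\<in>I. c $ f i) = eval_cpoly (Poly_Mapping.single m a) c"
      by (simp add: eval_cpoly_superset [of "{m}"] m(3))
  qed
qed

section \<open>The functions of a circulant matrix\<close>

lemma form_function_G_circ: "form_function n n (\<lambda>c. G n \<phi> k (circ n c))"
proof -
  have signed_term: "form_function n n (\<lambda>c. signed_term n \<sigma> (circ n c) * w)"
    if \<sigma>: "\<sigma> permutes {1..n}" for \<sigma> w
  proof -
    let ?f = "\<lambda>i. (\<sigma> i - 1 + n - (i - 1)) mod n"
    have entry: "circ n c $$ (i - 1, \<sigma> i - 1) = c $ ?f i" if i: "i \<in> {1..n}" for i c
    proof -
      have "\<sigma> i \<in> {1..n}" using permutes_in_image [OF \<sigma>] i by blast
      with i show ?thesis by (auto simp: circ_def)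
    qed
    have "signed_term n \<sigma> (circ n c) * w = of_int (sign \<sigma>) * w * (\<Prod>i\<in>{1..n}. c $ ?f i)" for c
    proof -
      have "(\<Prod>i\<in>{1..n}. circ n c $$ (i - 1, \<sigma> i - 1)) = (\<Prod>i\<in>{1..n}. c $ ?f i)"
        by (intro prod.cong refl entry)
      then show ?thesis
        unfolding signed_term_def by (simp only: mult_ac)
    qed
    moreover have "form_function n n (\<lambda>c. of_int (sign \<sigma>) * w * (\<Prod>i\<in>{1..n}. c $ ?f i))"
      by (rule form_function_product_of_variables) auto
    ultimately show ?thesis by presburger
  qed
  show ?thesis
    unfolding G_def Lambda_def sum_distrib_right
    by (intro form_function_sum) (auto intro: signed_term)
qed

lemma form_function_circ_eigenvalue: "form_function n 1 (\<lambda>c. circ_eigenvalue n k (circ n c))"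
proof -
  have "form_function n 1 (\<lambda>c. c $ j * omega n ^ (k * j))" if "j < n" for j
    using form_function_product_of_variables [of "{0 :: nat}" "\<lambda>_. j" n 1 "omega n ^ (k * j)"] that
    by (simp add: mult.commute)
  then show ?thesis
    unfolding circ_eigenvalue_circ by (intro form_function_sum) simp
qed

section \<open>Scalar matrices\<close>

text \<open>
  A permutation other than the identity moves some \<open>i\<close> and so picks an off-diagonal entry of
  the scalar matrix, which kills its term.
\<close>

lemma signed_term_circ_scalar:
  assumes \<sigma>: "\<sigma> permutes {1..n}"
  shows "signed_term n \<sigma> (circ n (t \<cdot>\<^sub>v unit_vec n 0)) = (if \<sigma> = id then t ^ n else 0)"
proof (cases "\<sigma> = id")
  case True
  have "circ n (t \<cdot>\<^sub>v unit_vec n 0) $$ (i - 1, i - 1) = t" if "i \<in> {1..n}" for i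
    using that by (auto simp: circ_def)
  then show ?thesis
    using True by (simp add: signed_term_def sign_id)
next
  case False
  then obtain i where ne: "\<sigma> i \<noteq> i" by (auto simp: fun_eq_iff)
  then have i: "i \<in> {1..n}" using \<sigma> by (meson permutes_not_in)
  then have si: "\<sigma> i \<in> {1..n}" using permutes_in_image [OF \<sigma>] by blast
  have "(\<sigma> i - 1 + n - (i - 1)) mod n \<noteq> 0"
  proof (cases "i \<le> \<sigma> i")
    case True
    then have "\<sigma> i - 1 + n - (i - 1) = (\<sigma> i - i) + n" using i by auto
    moreover have "(\<sigma> i - i) mod n = \<sigma> i - i" using i si by auto
    ultimately have "(\<sigma> i - 1 + n - (i - 1)) mod n = \<sigma> i - i" by (metis mod_add_self2)
    then show ?thesis using ne True by simp
  next
    case False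
    then have "\<sigma> i - 1 + n - (i - 1) = n - (i - \<sigma> i)" using i si by auto
    moreover have "(n - (i - \<sigma> i)) mod n = n - (i - \<sigma> i)" using False i by auto
    ultimately show ?thesis using False i si by auto
  qed
  moreover have "i - 1 < n" and "\<sigma> i - 1 < n" using i si by auto
  ultimately have "circ n (t \<cdot>\<^sub>v unit_vec n 0) $$ (i - 1, \<sigma> i - 1) = 0"
    by (simp add: circ_def)
  then have "(\<Prod>i\<in>{1..n}. circ n (t \<cdot>\<^sub>v unit_vec n 0) $$ (i - 1, \<sigma> i - 1)) = 0"
    using i by (intro prod_zero) auto
  then show ?thesis
    using False by (simp add: signed_term_def)
qed

lemma phase_function_id:
  assumes "phase_function n \<phi>" and "0 < n"
  shows "\<phi> id = 0"
proof -
  have "\<phi> (id \<circ> (rho n ^^ 0)) = 0"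
    using assms permutes_id [of "{1..n}"] unfolding phase_function_def by (metis id_apply)
  then show ?thesis by (simp add: id_def comp_def)
qed

lemma G_circ_scalar:
  assumes "phase_function n \<phi>" and "0 < n"
  shows "G n \<phi> k (circ n (t \<cdot>\<^sub>v unit_vec n 0)) = t ^ n"
proof -
  have "Lambda n \<phi> r (circ n (t \<cdot>\<^sub>v unit_vec n 0)) = (if r = 0 then t ^ n else 0)" for r
  proof -
    let ?P = "{\<sigma>. \<sigma> permutes {1..n} \<and> \<phi> \<sigma> = r}"
    have "finite ?P"
      by (rule finite_subset [OF _ finite_permutations [of "{1..n}"]]) auto
    moreover have "Lambda n \<phi> r (circ n (t \<cdot>\<^sub>v unit_vec n 0)) =
        (\<Sum>\<sigma>\<in>?P. if \<sigma> = id then t ^ n else 0)"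
      unfolding Lambda_def by (intro sum.cong refl signed_term_circ_scalar) simp
    ultimately show ?thesis
      using phase_function_id [OF assms] permutes_id [of "{1..n}"] by auto
  qed
  then have "G n \<phi> k (circ n (t \<cdot>\<^sub>v unit_vec n 0)) =
      (\<Sum>r<n. if r = 0 then t ^ n else 0)"
    unfolding G_def by (intro sum.cong) auto
  also have "\<dots> = t ^ n" using assms(2) by simp
  finally show ?thesis .
qed

lemma circ_eigenvalue_scalar:
  assumes "0 < n"
  shows "circ_eigenvalue n k (circ n (t \<cdot>\<^sub>v unit_vec n 0)) = t"
proof -
  have "circ_eigenvalue n k (circ n (t \<cdot>\<^sub>v unit_vec n 0)) = (\<Sum>j<n. if j = 0 then t else 0)"
    unfolding circ_eigenvalue_circ by (intro sum.cong) auto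
  then show ?thesis using assms by simp
qed

theorem theorem11p12:
  fixes n k :: nat and \<phi> :: "(nat \<Rightarrow> nat) \<Rightarrow> nat"
  assumes "n \<ge> 2" and "phase_function n \<phi>" and "k < n"
  shows "homogeneous_polynomial_function n n (\<lambda>c. G n \<phi> k (circ n c)) \<and>
    (\<forall>c \<in> carrier_vec n. circ_eigenvalue n k (circ n c) = (\<Sum>j<n. c $ j * omega n ^ (k * j))) \<and>
    homogeneous_polynomial_function n 1 (\<lambda>c. circ_eigenvalue n k (circ n c)) \<and>
    \<not> (\<forall>C \<in> carrier_mat n n. circulant n C \<longrightarrow> G n \<phi> k C = circ_eigenvalue n k C)"
proof (intro conjI ballI)
  have n: "0 < n" using assms(1) by simp
  let ?c = "\<lambda>t :: complex. t \<cdot>\<^sub>v unit_vec n 0"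
  have c: "?c t \<in> carrier_vec n" for t by simp
  show "homogeneous_polynomial_function n n (\<lambda>c. G n \<phi> k (circ n c))"
    by (rule homogeneous_polynomial_function_if_nonzero_value [OF form_function_G_circ c [of 1]])
      (simp only: G_circ_scalar [OF assms(2) n], simp)
  show "homogeneous_polynomial_function n 1 (\<lambda>c. circ_eigenvalue n k (circ n c))"
    by (rule homogeneous_polynomial_function_if_nonzero_value
          [OF form_function_circ_eigenvalue c [of 1]])
      (simp only: circ_eigenvalue_scalar [OF n], simp)
  show "circ_eigenvalue n k (circ n c) = (\<Sum>j<n. c $ j * omega n ^ (k * j))" for c
    by (rule circ_eigenvalue_circ)
  show "\<not> (\<forall>C \<in> carrier_mat n n. circulant n C \<longrightarrow> G n \<phi> k C = circ_eigenvalue n k C)"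
  proof
    assume eq: "\<forall>C \<in> carrier_mat n n. circulant n C \<longrightarrow> G n \<phi> k C = circ_eigenvalue n k C"
    have "circulant n (circ n (?c 2))"
      unfolding circulant_def using c by blast
    moreover have "circ n (?c 2) \<in> carrier_mat n n"
      by (simp add: circ_def)
    ultimately have "G n \<phi> k (circ n (?c 2)) = circ_eigenvalue n k (circ n (?c 2))"
      using eq by blast
    then have "(2 :: complex) ^ n = 2"
      by (simp only: G_circ_scalar [OF assms(2) n] circ_eigenvalue_scalar [OF n])
    then have "(of_nat (2 ^ n) :: complex) = of_nat (2 ^ 1)"
      by simp
    then have "(2 :: nat) ^ n = 2 ^ 1"
      by (simp only: of_nat_eq_iff)
    then show False
      using assms(1) power_inject_exp [of "2 :: nat" n 1] by linarith
  qed
qed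

end
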